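(* Let $G$ be a banana tree, and let $k$ be the largest positive integer such that there exists a set $W$ of at least $k$ vertices of $G$ inducing a connected subgraph in which every pair of adjacent vertices is joined by at least $k$ edges. Then $\mathrm{sn}(G)=\mathrm{scw}(G)=k$.
   Context: Graphs are finite, connected, loopless multigraphs. A banana tree is a multigraph whose underlying simple graph (one edge kept between each adjacent pair) is a tree. For $S\subseteq V(G)$, $G[S]$ is the induced subgraph. A scramble on $G$ is a finite collection $\mathcal{S}=\{V_1,\ldots,V_m\}$ of nonempty vertex sets (eggs) with each $G[V_i]$ connected. The hitting number $h(\mathcal{S})$ is the minimum size of a vertex set meeting every egg. An egg-cut is a set $T$ of edges such that $(V(G),E(G)\setminus T)$ has at least two connected components each of which completely contains some egg; the egg-cut number $e(\mathcal{S})$ is the minimum size of an egg-cut (taken to be $\infty$ if none exists). The order of $\mathcal{S}$ is $\min\{h(\mathcal{S}),e(\mathcal{S})\}$, and the scramble number $\mathrm{sn}(G)$ is the maximum order of a scramble on $G$. A tree-cut decomposition of $G$ is a pair $(T,\mathcal{X})$ where $T$ is a tree (whose vertices are called nodes and edges links) and $\mathcal{X}:V(G)\to V(T)$ is any function. Each edge $uv$ of $G$ is routed along the unique path in $T$ from $\mathcal{X}(u)$ to $\mathcal{X}(v)$. The weight of a link is the number of edges of $G$ whose path uses that link; the weight of a node $t$ is $|\mathcal{X}^{-1}(t)|$ plus the number of edges of $G$ whose path passes through $t$ but neither of whose endpoints is mapped to $t$. The width of the decomposition is the maximum weight of a node or link, and the screewidth $\mathrm{scw}(G)$ is the minimum width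 of a tree-cut decomposition of $G$. *)

theory Defs
  imports Main "HOL-Library.Extended_Nat"
begin

text \<open>Undirected multigraphs: edges are abstract names, so parallel edges are distinct
  elements with the same set of ends.\<close>

record ('v, 'e) mgraph =
  verts :: "'v set"
  edges :: "'e set"
  ends :: "'e \<Rightarrow> 'v set"

definition edges_between :: "('v, 'e) mgraph \<Rightarrow> 'v \<Rightarrow> 'v \<Rightarrow> 'e set" where
  "edges_between G u v = {e \<in> edges G. ends G e = {u, v}}"

definition adjacent :: "('v, 'e) mgraph \<Rightarrow> 'v \<Rightarrow> 'v \<Rightarrow> bool" where
  "adjacent G u v \<longleftrightarrow> (\<exists>e \<in> edges G. ends G e = {u, v})"

definition connected_graph :: "('v, 'e) mgraph \<Rightarrow> bool" where
  "connected_graph G \<longleftrightarrow>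
     verts G \<noteq> {} \<and> (\<forall>u \<in> verts G. \<forall>v \<in> verts G. (adjacent G)\<^sup>*\<^sup>* u v)"

definition components :: "('v, 'e) mgraph \<Rightarrow> 'v set set" where
  "components G = (\<lambda>u. {v. (adjacent G)\<^sup>*\<^sup>* u v}) ` verts G"

definition multigraph :: "('v, 'e) mgraph \<Rightarrow> bool" where
  "multigraph G \<longleftrightarrow> finite (verts G) \<and> finite (edges G) \<and>
     (\<forall>e \<in> edges G. ends G e \<subseteq> verts G \<and> card (ends G e) = 2) \<and> connected_graph G"

definition induced :: "('v, 'e) mgraph \<Rightarrow> 'v set \<Rightarrow> ('v, 'e) mgraph" where
  "induced G S = \<lparr>verts = S, edges = {e \<in> edges G. ends G e \<subseteq> S}, ends = ends G\<rparr>"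

definition delete_edges :: "('v, 'e) mgraph \<Rightarrow> 'e set \<Rightarrow> ('v, 'e) mgraph" where
  "delete_edges G D = \<lparr>verts = verts G, edges = edges G - D, ends = ends G\<rparr>"

definition underlying_simple :: "('v, 'e) mgraph \<Rightarrow> ('v, 'v set) mgraph" where
  "underlying_simple G = \<lparr>verts = verts G, edges = ends G ` edges G, ends = (\<lambda>l. l)\<rparr>"

definition cycle :: "('v, 'e) mgraph \<Rightarrow> 'v list \<Rightarrow> bool" where
  "cycle G c \<longleftrightarrow> 3 \<le> length c \<and> distinct c \<and> successively (adjacent G) c \<and>
     adjacent G (last c) (hd c)"

text \<open>Cycles are given by vertex lists of length at least 3; cycles of length 2 (parallel
  edges) are excluded by injectivity of the ends.\<close>

definition tree :: "('v, 'e) mgraph \<Rightarrow> bool" where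
  "tree T \<longleftrightarrow> multigraph T \<and> inj_on (ends T) (edges T) \<and> (\<nexists>c. cycle T c)"

definition banana_tree :: "('v, 'e) mgraph \<Rightarrow> bool" where
  "banana_tree G \<longleftrightarrow> multigraph G \<and> tree (underlying_simple G)"

definition scramble :: "('v, 'e) mgraph \<Rightarrow> 'v set set \<Rightarrow> bool" where
  "scramble G \<S> \<longleftrightarrow> finite \<S> \<and>
     (\<forall>A \<in> \<S>. A \<noteq> {} \<and> A \<subseteq> verts G \<and> connected_graph (induced G A))"

definition hitting_number :: "('v, 'e) mgraph \<Rightarrow> 'v set set \<Rightarrow> nat" where
  "hitting_number G \<S> = Min (card ` {C. C \<subseteq> verts G \<and> (\<forall>A \<in> \<S>. C \<inter> A \<noteq> {})})"

definition egg_cut :: "('v, 'e) mgraph \<Rightarrow> 'v set set \<Rightarrow> 'e set \<Rightarrow> bool" where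
  "egg_cut G \<S> D \<longleftrightarrow> D \<subseteq> edges G \<and>
     (\<exists>C1 \<in> components (delete_edges G D). \<exists>C2 \<in> components (delete_edges G D).
        C1 \<noteq> C2 \<and> (\<exists>A \<in> \<S>. A \<subseteq> C1) \<and> (\<exists>A \<in> \<S>. A \<subseteq> C2))"

text \<open>The infimum of the empty set in \<^typ>\<open>enat\<close> is infinity.\<close>

definition egg_cut_number :: "('v, 'e) mgraph \<Rightarrow> 'v set set \<Rightarrow> enat" where
  "egg_cut_number G \<S> = Inf {enat (card D) | D. egg_cut G \<S> D}"

definition scramble_order :: "('v, 'e) mgraph \<Rightarrow> 'v set set \<Rightarrow> enat" where
  "scramble_order G \<S> = min (enat (hitting_number G \<S>)) (egg_cut_number G \<S>)"

definition scramble_number :: "('v, 'e) mgraph \<Rightarrow> enat" where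
  "scramble_number G = Max (scramble_order G ` {\<S>. scramble G \<S>})"

definition path :: "('n, 'l) mgraph \<Rightarrow> 'n \<Rightarrow> 'n list \<Rightarrow> 'n \<Rightarrow> bool" where
  "path T a p b \<longleftrightarrow> p \<noteq> [] \<and> hd p = a \<and> last p = b \<and> set p \<subseteq> verts T \<and> distinct p \<and>
     successively (adjacent T) p"

definition tree_cut_decomposition ::
  "('v, 'e) mgraph \<Rightarrow> ('n, 'l) mgraph \<Rightarrow> ('v \<Rightarrow> 'n) \<Rightarrow> bool" where
  "tree_cut_decomposition G T X \<longleftrightarrow> tree T \<and> X ` verts G \<subseteq> verts T"

text \<open>In a tree the path between two nodes is unique, so it may be bound existentially.
  Reversing it, i.e. exchanging the ends of the edge, does not change which nodes and links
  lie on it.\<close>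

definition routed_along ::
  "('v, 'e) mgraph \<Rightarrow> ('n, 'l) mgraph \<Rightarrow> ('v \<Rightarrow> 'n) \<Rightarrow> 'e \<Rightarrow> 'n list \<Rightarrow> bool" where
  "routed_along G T X e p \<longleftrightarrow> (\<exists>u v. ends G e = {u, v} \<and> path T (X u) p (X v))"

definition path_links :: "('n, 'l) mgraph \<Rightarrow> 'n list \<Rightarrow> 'l set" where
  "path_links T p = (\<Union>i \<in> {i. Suc i < length p}. edges_between T (p ! i) (p ! Suc i))"

definition link_weight ::
  "('v, 'e) mgraph \<Rightarrow> ('n, 'l) mgraph \<Rightarrow> ('v \<Rightarrow> 'n) \<Rightarrow> 'l \<Rightarrow> nat" where
  "link_weight G T X l =
     card {e \<in> edges G. \<exists>p. routed_along G T X e p \<and> l \<in> path_links T p}"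

definition node_weight ::
  "('v, 'e) mgraph \<Rightarrow> ('n, 'l) mgraph \<Rightarrow> ('v \<Rightarrow> 'n) \<Rightarrow> 'n \<Rightarrow> nat" where
  "node_weight G T X t = card {v \<in> verts G. X v = t} +
     card {e \<in> edges G. (\<exists>p. routed_along G T X e p \<and> t \<in> set p) \<and> t \<notin> X ` ends G e}"

definition width :: "('v, 'e) mgraph \<Rightarrow> ('n, 'l) mgraph \<Rightarrow> ('v \<Rightarrow> 'n) \<Rightarrow> nat" where
  "width G T X = Max (node_weight G T X ` verts T \<union> link_weight G T X ` edges T)"

text \<open>Every finite tree is isomorphic to one whose nodes and links are natural numbers.\<close>

definition screewidth :: "('v, 'e) mgraph \<Rightarrow> nat" where
  "screewidth G = (LEAST w. \<exists>(T :: (nat, nat) mgraph) X.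
     tree_cut_decomposition G T X \<and> width G T X = w)"

definition has_banana_core :: "('v, 'e) mgraph \<Rightarrow> nat \<Rightarrow> bool" where
  "has_banana_core G k \<longleftrightarrow> (\<exists>W \<subseteq> verts G. k \<le> card W \<and> connected_graph (induced G W) \<and>
     (\<forall>u v. adjacent (induced G W) u v \<longrightarrow> k \<le> card (edges_between (induced G W) u v)))"

end

theory Submission
  imports Defs
begin

text \<open>Both invariants are squeezed in the chain \<open>k\<close> \<le> sn \<le> scw \<le>
  \<open>k\<close>.

  Lower bound (\<open>scramble_number_ge_core\<close>): the singletons of a core \<open>W\<close>
  form a scramble. A hitting set must contain \<open>W\<close>, and deleting fewer than
  \<open>k\<close> edges exhausts no bundle inside \<open>W\<close>, so \<open>W\<close> stays in
  one component.

  Middle inequality (\<open>scramble_order_le_width\<close>), valid for every multigraph: take a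
  scramble whose order exceeds the width of a tree-cut decomposition. At a node \<open>t\<close>,
  collect the vertices of the bag together with one end of each edge passing over \<open>t\<close>.
  This set is too small to hit all eggs, and a missed egg lies in a single component of
  \<open>T - t\<close>, so \<open>t\<close> can point to its neighbour there. In a finite tree two
  adjacent nodes must then point at each other (\<open>acyclic_walk_turns_back\<close>). The edges
  routed over their link separate the two eggs, yet there are at most width many of them, a
  contradiction.

  Upper bound (\<open>thin_tree_cut_decomposition\<close>): contract every bundle of more than
  \<open>k\<close> edges. A class with more than \<open>k\<close> vertices would be a core for
  \<open>Suc k\<close>, against maximality. The quotient is a tree in which each link carries one
  uncontracted bundle and no edge passes over a foreign node, so the width is at most
  \<open>k\<close>.

  Tree arguments rest on the equivalence of acyclicity with every adjacency being a bridge.\<close>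

section \<open>Adjacency, reachability and simple paths\<close>

lemma adjacent_sym: "adjacent G u v \<Longrightarrow> adjacent G v u"
  by (simp add: adjacent_def insert_commute)

lemma adjacent_in_verts:
  assumes "multigraph G" "adjacent G u v"
  shows "u \<in> verts G" "v \<in> verts G" "u \<noteq> v"
proof -
  obtain e where e: "e \<in> edges G" "ends G e = {u, v}"
    using assms(2) by (auto simp: adjacent_def)
  then have "{u, v} \<subseteq> verts G" "card {u, v} = 2"
    using assms(1) unfolding multigraph_def by metis+
  then show "u \<in> verts G" "v \<in> verts G" "u \<noteq> v" by auto
qed

lemma rtranclp_sym:
  assumes "\<And>x y. R x y \<Longrightarrow> R y x" "R\<^sup>*\<^sup>* a b"
  shows "R\<^sup>*\<^sup>* b a"
  using assms(2) by induction (auto intro: assms(1) converse_rtranclp_into_rtranclp)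

lemma rtranclp_image:
  assumes "\<And>x y. R x y \<Longrightarrow> S\<^sup>*\<^sup>* (f x) (f y)" "R\<^sup>*\<^sup>* a b"
  shows "S\<^sup>*\<^sup>* (f a) (f b)"
  using assms(2) by induction (blast intro: rtranclp_trans assms(1))+

lemma adjacent_rtranclp_sym: "(adjacent G)\<^sup>*\<^sup>* u v \<Longrightarrow> (adjacent G)\<^sup>*\<^sup>* v u"
  by (rule rtranclp_sym) (auto intro: adjacent_sym)

lemma rtranclp_simple_path:
  assumes "R\<^sup>*\<^sup>* a b"
  obtains p where "p \<noteq> []" "hd p = a" "last p = b" "distinct p" "successively R p"
proof -
  from assms have "\<exists>p. p \<noteq> [] \<and> hd p = a \<and> last p = b \<and> distinct p \<and> successively R p"
  proof (induction rule: converse_rtranclp_induct)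
    case base
    show ?case by (rule exI[of _ "[b]"]) simp
  next
    case (step y z)
    then obtain p where p: "p \<noteq> []" "hd p = z" "last p = b" "distinct p" "successively R p"
      by blast
    show ?case
    proof (cases "y \<in> set p")
      case True
      \<comment> \<open>A repeated start vertex is removed by beginning the path at its earlier
        occurrence.\<close>
      then obtain xs ys where "p = xs @ y # ys" by (meson split_list)
      with p show ?thesis
        by (intro exI[of _ "y # ys"]) (auto simp: successively_append_iff)
    next
      case False
      with p step.hyps(1) show ?thesis
        by (intro exI[of _ "y # p"]) (auto simp: successively_Cons)
    qed
  qed
  with that show thesis by blast
qed

lemma successively_rtranclp:
  "successively R p \<Longrightarrow> p \<noteq> [] \<Longrightarrow> R\<^sup>*\<^sup>* (hd p) (last p)"
  by (induction p) (auto simp: successively_Cons intro: converse_rtranclp_into_rtranclp)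

section \<open>Acyclicity: bridges and fixed-point-free walks\<close>

text \<open>A detour shortens to a simple path, which has at least three vertices because the pair
  itself is forbidden; the adjacency closes it to a cycle. The whole bundle between \<open>u\<close>
  and \<open>v\<close> is excluded at once, so parallel edges do no harm.\<close>

lemma edge_is_bridge_if_acyclic:
  assumes "\<nexists>c. cycle G c" "adjacent G u v" "u \<noteq> v"
  shows "\<not> (\<lambda>x y. adjacent G x y \<and> {x, y} \<noteq> {u, v})\<^sup>*\<^sup>* u v"
proof
  let ?R = "\<lambda>x y. adjacent G x y \<and> {x, y} \<noteq> {u, v}"
  assume "?R\<^sup>*\<^sup>* u v"
  then obtain p where p: "p \<noteq> []" "hd p = u" "last p = v" "distinct p" "successively ?R p"
    by (rule rtranclp_simple_path)
  have "3 \<le> length p"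
  proof (rule ccontr)
    assume "\<not> 3 \<le> length p"
    then consider "length p = 0" | "length p = 1" | "length p = 2" by linarith
    then show False
    proof cases
      case 3
      then obtain x y where "p = [x, y]" by (auto simp: length_Suc_conv numeral_2_eq_2)
      with p show False by simp
    qed (use p assms(3) in \<open>auto simp: length_Suc_conv\<close>)
  qed
  moreover have "successively (adjacent G) p"
    using p(5) by (rule successively_mono) auto
  ultimately have "cycle G p"
    using p assms(2) by (auto simp: cycle_def intro: adjacent_sym)
  with assms(1) show False by blast
qed

text \<open>A cycle bypasses its own closing pair: with at least three distinct vertices,
  \<open>{hd c, last c}\<close> is not a pair of consecutive entries.\<close>

lemma acyclic_if_edges_are_bridges:
  assumes "\<And>u v. adjacent G u v \<Longrightarrow>
    \<not> (\<lambda>x y. adjacent G x y \<and> {x, y} \<noteq> {u, v})\<^sup>*\<^sup>* u v"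
  shows "\<nexists>c. cycle G c"
proof
  assume "\<exists>c. cycle G c"
  then obtain c where c: "3 \<le> length c" "distinct c" "successively (adjacent G) c"
    "adjacent G (last c) (hd c)"
    by (auto simp: cycle_def)
  let ?R = "\<lambda>x y. adjacent G x y \<and> {x, y} \<noteq> {hd c, last c}"
  have "c \<noteq> []" using c(1) by auto
  have "successively ?R c"
    unfolding successively_conv_nth
  proof (intro allI impI conjI)
    fix i assume i: "Suc i < length c"
    then show "adjacent G (c ! i) (c ! Suc i)"
      using c(3) by (simp add: successively_conv_nth)
    show "{c ! i, c ! Suc i} \<noteq> {hd c, last c}"
      using i c(1,2) \<open>c \<noteq> []\<close>
      by (auto simp: hd_conv_nth last_conv_nth doubleton_eq_iff nth_eq_iff_index_eq)
  qed
  then have "?R\<^sup>*\<^sup>* (hd c) (last c)"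
    using \<open>c \<noteq> []\<close> by (rule successively_rtranclp)
  with assms[OF adjacent_sym[OF c(4)]] show False by blast
qed

text \<open>By finiteness the iterates of \<open>f\<close> enter a periodic orbit. Its minimal
  period is not 1, as there are no loops, and not 3 or more, as the orbit would be a cycle; so it is
  2.\<close>

lemma acyclic_walk_turns_back:
  assumes "multigraph G" "\<nexists>c. cycle G c"
    and f: "\<And>v. v \<in> verts G \<Longrightarrow> adjacent G v (f v)"
  obtains v where "v \<in> verts G" "f (f v) = v"
proof -
  obtain x where x: "x \<in> verts G"
    using assms(1) by (auto simp: multigraph_def connected_graph_def)
  have orbit: "(f ^^ n) y \<in> verts G" if "y \<in> verts G" for n y
    using that by (induction n) (auto dest: f adjacent_in_verts(2)[OF assms(1)])
  have "\<not> inj (\<lambda>n. (f ^^ n) x)"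
  proof
    assume "inj (\<lambda>n. (f ^^ n) x)"
    moreover have "range (\<lambda>n. (f ^^ n) x) \<subseteq> verts G" using orbit[OF x] by blast
    ultimately show False
      using assms(1) by (meson finite_imageD finite_subset infinite_UNIV_nat multigraph_def)
  qed
  then obtain i j where ij: "i < j" "(f ^^ i) x = (f ^^ j) x"
    unfolding inj_def by (metis linorder_neqE_nat)
  define y where "y = (f ^^ i) x"
  have y: "y \<in> verts G" by (simp add: y_def orbit[OF x])
  define P where "P n \<longleftrightarrow> 0 < n \<and> (f ^^ n) y = y" for n
  have "(f ^^ (j - i)) y = (f ^^ (j - i + i)) x" by (simp only: y_def funpow_add o_apply)
  then have "P (j - i)" using ij by (simp add: P_def y_def)
  define n where "n = (LEAST n. P n)"
  have n: "0 < n" "(f ^^ n) y = y"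
    using LeastI[of P, OF \<open>P (j - i)\<close>] by (auto simp: n_def P_def)
  have least: "n \<le> m" if "P m" for m using that by (simp add: n_def Least_le)
  have inj: "(f ^^ a) y \<noteq> (f ^^ b) y" if "a < b" "b < n" for a b
  proof
    assume eq: "(f ^^ a) y = (f ^^ b) y"
    \<comment> \<open>Applying \<open>f\<close> another \<open>n - b\<close> times to both sides
      returns the right side to \<open>y\<close>, which gives the smaller period
      \<open>n - b + a\<close>.\<close>
    have "(f ^^ (n - b + a)) y = (f ^^ (n - b + b)) y"
      by (simp only: funpow_add o_apply eq)
    then have "P (n - b + a)" using that n by (simp add: P_def)
    from least[OF this] that show False by simp
  qed
  have step: "adjacent G ((f ^^ a) y) ((f ^^ Suc a) y)" for a
    using f[OF orbit[OF y]] by simp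
  consider "n = 1" | "n = 2" | "3 \<le> n" using n(1) by linarith
  then show thesis
  proof cases
    case 1
    with n(2) f[OF y] adjacent_in_verts(3)[OF assms(1)] show thesis by fastforce
  next
    case 2
    with n(2) y that show thesis by (simp add: numeral_2_eq_2)
  next
    case 3
    define c where "c = map (\<lambda>a. (f ^^ a) y) [0..<n]"
    have [simp]: "length c = n" "c \<noteq> []" using n(1) by (auto simp: c_def)
    have "distinct c"
      unfolding distinct_conv_nth
      by (auto simp: c_def) (metis inj linorder_neqE_nat)
    moreover have "successively (adjacent G) c"
      unfolding successively_conv_nth using step by (auto simp: c_def)
    moreover have "adjacent G (last c) (hd c)"
      using step[of "n - 1"] n by (simp add: c_def hd_map last_map)
    ultimately have "cycle G c" using 3 by (simp add: cycle_def)
    with assms(2) show thesis by blast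
  qed
qed

section \<open>Lower bound: the scramble of a core\<close>

lemma finite_scrambles: "finite (verts G) \<Longrightarrow> finite {\<S>. scramble G \<S>}"
  by (rule finite_subset[of _ "Pow (Pow (verts G))"]) (auto simp: scramble_def)

lemma hitting_number_le:
  assumes "finite (verts G)" "C \<subseteq> verts G" "\<And>A. A \<in> \<S> \<Longrightarrow> C \<inter> A \<noteq> {}"
  shows "hitting_number G \<S> \<le> card C"
  unfolding hitting_number_def by (rule Min_le) (use assms in auto)

text \<open>The witness is the scramble of all singletons of the core: only supersets of
  \<open>W\<close> hit it, and small cuts leave \<open>W\<close> connected.\<close>

lemma scramble_number_ge_core:
  assumes G: "multigraph G" and core: "has_banana_core G k"
  shows "enat k \<le> scramble_number G"
proof -
  obtain W where W: "W \<subseteq> verts G" "k \<le> card W" "connected_graph (induced G W)"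
    and thick: "\<And>u v. adjacent (induced G W) u v \<Longrightarrow>
      k \<le> card (edges_between (induced G W) u v)"
    using core unfolding has_banana_core_def by blast
  have fin: "finite (verts G)" "finite (edges G)" using G by (auto simp: multigraph_def)
  define \<S> where "\<S> = (\<lambda>v. {v}) ` W"
  have scr: "scramble G \<S>"
    using W(1) fin(1) by (auto simp: scramble_def \<S>_def connected_graph_def induced_def
        intro: finite_subset)
  have hit: "k \<le> hitting_number G \<S>"
    unfolding hitting_number_def
  proof (rule Min.boundedI)
    show "card ` {C. C \<subseteq> verts G \<and> (\<forall>A \<in> \<S>. C \<inter> A \<noteq> {})} \<noteq> {}"
      using W(1) by (auto simp: \<S>_def)
    fix m assume "m \<in> card ` {C. C \<subseteq> verts G \<and> (\<forall>A \<in> \<S>. C \<inter> A \<noteq> {})}"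
    then obtain C where "m = card C" "C \<subseteq> verts G" "W \<subseteq> C" by (auto simp: \<S>_def)
    then show "k \<le> m"
      using W(2) card_mono[of C W] finite_subset[OF _ fin(1)] by fastforce
  qed (use fin in auto)
  have cut: "k \<le> card D" if D: "egg_cut G \<S> D" for D
  proof (rule ccontr)
    assume small: "\<not> k \<le> card D"
    let ?H = "delete_edges G D"
    have DE: "D \<subseteq> edges G" using D by (simp add: egg_cut_def)
    obtain C1 C2 A1 A2 where comps: "C1 \<in> components ?H" "C2 \<in> components ?H" "C1 \<noteq> C2"
      and eggs: "A1 \<in> \<S>" "A2 \<in> \<S>" "A1 \<subseteq> C1" "A2 \<subseteq> C2"
      using D unfolding egg_cut_def by blast
    obtain u v where uv: "u \<in> W" "v \<in> W" "u \<in> C1" "v \<in> C2"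
      using eggs by (auto simp: \<S>_def)
    obtain a where a: "C1 = {x. (adjacent ?H)\<^sup>*\<^sup>* a x}"
      using comps(1) by (auto simp: components_def)
    obtain b where b: "C2 = {x. (adjacent ?H)\<^sup>*\<^sup>* b x}"
      using comps(2) by (auto simp: components_def)
    have "(adjacent (induced G W))\<^sup>*\<^sup>* u v"
      using W(3) uv(1,2) by (auto simp: connected_graph_def induced_def)
    moreover have "adjacent (induced G W) x y \<Longrightarrow> adjacent ?H x y" for x y
    proof -
      assume "adjacent (induced G W) x y"
      \<comment> \<open>A bundle inside \<open>W\<close> has more edges than \<open>D\<close>, so
        one of them survives the deletion.\<close>
      then have "card D < card (edges_between (induced G W) x y)"
        using thick small by force
      moreover have "finite D" using DE fin(2) by (rule finite_subset)
      ultimately have "\<not> edges_between (induced G W) x y \<subseteq> D"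
        using card_mono by (metis not_le)
      then show "adjacent ?H x y"
        by (auto simp: edges_between_def induced_def adjacent_def delete_edges_def)
    qed
    ultimately have "(adjacent ?H)\<^sup>*\<^sup>* u v" by (metis mono_rtranclp)
    then have "(adjacent ?H)\<^sup>*\<^sup>* a b"
      using uv(3,4) unfolding a b mem_Collect_eq by (meson adjacent_rtranclp_sym rtranclp_trans)
    then have "(adjacent ?H)\<^sup>*\<^sup>* a x \<longleftrightarrow> (adjacent ?H)\<^sup>*\<^sup>* b x" for x
      by (meson adjacent_rtranclp_sym rtranclp_trans)
    then have "C1 = C2" unfolding a b by blast
    with comps(3) show False ..
  qed
  have "enat k \<le> egg_cut_number G \<S>"
    unfolding egg_cut_number_def by (rule Inf_greatest) (auto dest: cut)
  with hit have "enat k \<le> scramble_order G \<S>" by (simp add: scramble_order_def)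
  also have "\<dots> \<le> scramble_number G"
    unfolding scramble_number_def
    by (rule Max_ge) (use scr finite_scrambles[OF fin(1)] in auto)
  finally show ?thesis .
qed

section \<open>Scramble order is bounded by width\<close>

lemma path_exists:
  assumes "multigraph T" "a \<in> verts T" "b \<in> verts T"
  obtains p where "path T a p b"
proof -
  have "(adjacent T)\<^sup>*\<^sup>* a b" using assms by (auto simp: multigraph_def connected_graph_def)
  then obtain p where p: "p \<noteq> []" "hd p = a" "last p = b" "distinct p"
    "successively (adjacent T) p"
    by (rule rtranclp_simple_path)
  have "set p \<subseteq> verts T"
  proof
    fix x assume "x \<in> set p"
    then obtain i where i: "i < length p" "x = p ! i" by (metis in_set_conv_nth)
    show "x \<in> verts T"
    proof (cases i)
      case 0
      with i p(1,2) assms(2) show ?thesis by (simp add: hd_conv_nth)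
    next
      case (Suc j)
      then have "adjacent T (p ! j) x" using i p(5) by (simp add: successively_conv_nth)
      then show ?thesis by (rule adjacent_in_verts(2)[OF assms(1)])
    qed
  qed
  with p that show thesis by (auto simp: path_def)
qed

lemma ends_eq_pair:
  assumes "multigraph G" "e \<in> edges G"
  obtains u v where "ends G e = {u, v}" "u \<in> verts G" "v \<in> verts G" "u \<noteq> v"
proof -
  have "ends G e \<subseteq> verts G" "card (ends G e) = 2" using assms by (auto simp: multigraph_def)
  with that show thesis by (auto simp: card_2_iff)
qed

text \<open>If the order exceeded the width, every node \<open>t\<close> would miss an egg lying in a single
  component of \<open>T - t\<close>. Walking from each node towards its egg, the walk must turn back over
  some link, and the edges routed over that link separate the two eggs.\<close>

lemma scramble_order_le_width:
  assumes G: "multigraph G" and tcd: "tree_cut_decomposition G T X" and S: "scramble G \<S>"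
  shows "scramble_order G \<S> \<le> enat (width G T X)"
proof (rule ccontr)
  assume "\<not> scramble_order G \<S> \<le> enat (width G T X)"
  then have hit: "width G T X < hitting_number G \<S>"
    and cut: "enat (width G T X) < egg_cut_number G \<S>"
    by (auto simp: scramble_order_def min_le_iff_disj not_le)
  have T: "multigraph T" "\<nexists>c. cycle T c"
    and X: "\<And>v. v \<in> verts G \<Longrightarrow> X v \<in> verts T"
    using tcd by (auto simp: tree_cut_decomposition_def tree_def)
  have fin: "finite (verts G)" "finite (edges G)" "finite (verts T)" "finite (edges T)"
    using G T(1) by (auto simp: multigraph_def)
  have node_le: "node_weight G T X t \<le> width G T X" if "t \<in> verts T" for t
    unfolding width_def by (rule Max_ge) (use fin that in auto)
  have link_le: "link_weight G T X l \<le> width G T X" if "l \<in> edges T" for l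
    unfolding width_def by (rule Max_ge) (use fin that in auto)
  \<comment> \<open>\<open>?R t\<close> is adjacency in the tree with node \<open>t\<close>
    removed.\<close>
  let ?R = "\<lambda>t x y. adjacent T x y \<and> x \<noteq> t \<and> y \<noteq> t"
  \<comment> \<open>\<open>Q t s A\<close>: the egg \<open>A\<close> lives in the component of
    \<open>T - t\<close> entered through the neighbour \<open>s\<close>. The last clause will keep
    the edges inside \<open>A\<close> out of the final cut.\<close>
  define Q where "Q t s A \<longleftrightarrow> adjacent T t s \<and> A \<in> \<S> \<and>
    (\<forall>a \<in> A. (?R t)\<^sup>*\<^sup>* s (X a)) \<and>
    (\<forall>e \<in> edges G. ends G e \<subseteq> A \<longrightarrow> (\<forall>p. routed_along G T X e p \<longrightarrow> t \<notin> set p))" for t s A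
  have "\<exists>s A. Q t s A" if t: "t \<in> verts T" for t
  proof -
    define E where "E = {e \<in> edges G. (\<exists>p. routed_along G T X e p \<and> t \<in> set p) \<and>
      t \<notin> X ` ends G e}"
    define g where "g e = (SOME v. v \<in> ends G e)" for e
    have g: "g e \<in> ends G e" "ends G e \<subseteq> verts G" if e: "e \<in> edges G" for e
    proof -
      obtain u v where "ends G e = {u, v}" "u \<in> verts G" "v \<in> verts G"
        using G e by (rule ends_eq_pair)
      then show "g e \<in> ends G e" "ends G e \<subseteq> verts G"
        using someI[of "\<lambda>v. v \<in> ends G e" u] by (auto simp: g_def)
    qed
    \<comment> \<open>The candidate hitting set: the bag of \<open>t\<close> and one chosen end of
      each edge passing over \<open>t\<close>, hence no larger than the node weight.\<close>
    define H where "H = {v \<in> verts G. X v = t} \<union> g ` E"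
    have "card H \<le> card {v \<in> verts G. X v = t} + card (g ` E)"
      unfolding H_def by (rule card_Un_le)
    also have "\<dots> \<le> node_weight G T X t"
      using card_image_le[of E g] fin(2) by (simp add: node_weight_def E_def)
    also have "\<dots> \<le> width G T X" using t by (rule node_le)
    finally have "card H < hitting_number G \<S>" using hit by simp
    moreover have "H \<subseteq> verts G" using g by (auto simp: H_def E_def)
    ultimately obtain A where A: "A \<in> \<S>" "H \<inter> A = {}"
      using hitting_number_le[OF fin(1), of H \<S>] by (meson not_le)
    then have AG: "A \<noteq> {}" "A \<subseteq> verts G" and conn: "connected_graph (induced G A)"
      using S by (auto simp: scramble_def)
    have At: "X a \<noteq> t" if "a \<in> A" for a
      using that A(2) AG(2) by (auto simp: H_def)
    have avoid: "t \<notin> set p" if "e \<in> edges G" "ends G e \<subseteq> A" "routed_along G T X e p" for e p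
    proof
      assume "t \<in> set p"
      moreover have "t \<notin> X ` ends G e" using At that(2) by blast
      ultimately have "e \<in> E" using that by (auto simp: E_def)
      \<comment> \<open>An edge inside \<open>A\<close> passing over \<open>t\<close> would have its
        chosen end in both \<open>H\<close> and \<open>A\<close>.\<close>
      then have "g e \<in> H \<inter> A" using g(1)[OF that(1)] that(2) by (auto simp: H_def)
      with A(2) show False by blast
    qed
    obtain a where a: "a \<in> A" using AG(1) by blast
    obtain p where p: "path T t p (X a)"
      using path_exists[OF T(1) t X] a AG(2) by blast
    \<comment> \<open>The second node of a path from \<open>t\<close> to the image of the egg is the
      direction in which \<open>t\<close> points.\<close>
    obtain s q where q: "p = t # s # q"
    proof -
      have "p \<noteq> []" "hd p = t" "last p = X a" using p by (auto simp: path_def)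
      with At[OF a] that show thesis by (cases p; cases "tl p") auto
    qed
    have "successively (?R t) (s # q)"
    proof (rule successively_mono[of "adjacent T"])
      show "successively (adjacent T) (s # q)" using p q by (simp add: path_def)
    qed (use p q in \<open>auto simp: path_def\<close>)
    then have sa: "(?R t)\<^sup>*\<^sup>* s (X a)"
      using successively_rtranclp[of "?R t" "s # q"] p q by (simp add: path_def)
    have step: "(?R t)\<^sup>*\<^sup>* (X x) (X y)" if xy: "adjacent (induced G A) x y" for x y
    proof -
      obtain e where e: "e \<in> edges G" "ends G e = {x, y}" "{x, y} \<subseteq> A"
        using xy by (auto simp: adjacent_def induced_def)
      then have "X x \<in> verts T" "X y \<in> verts T" using X AG(2) by auto
      then obtain r where r: "path T (X x) r (X y)" by (rule path_exists[OF T(1)])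
      then have "t \<notin> set r" using avoid[of e r] e by (auto simp: routed_along_def)
      then have "successively (?R t) r"
        using r by (intro successively_mono[of "adjacent T" r "?R t"]) (auto simp: path_def)
      then show ?thesis
        using successively_rtranclp r by (metis (no_types, lifting) path_def)
    qed
    have lift: "(?R t)\<^sup>*\<^sup>* (X x) (X y)" if "(adjacent (induced G A))\<^sup>*\<^sup>* x y" for x y
      by (rule rtranclp_image[OF _ that]) (rule step)
    have "(?R t)\<^sup>*\<^sup>* s (X b)" if "b \<in> A" for b
    proof -
      have "(adjacent (induced G A))\<^sup>*\<^sup>* a b"
        using conn a that by (auto simp: connected_graph_def induced_def)
      from rtranclp_trans[OF sa lift[OF this]] show ?thesis .
    qed
    moreover have "adjacent T t s" using p q by (simp add: path_def)
    ultimately have "Q t s A" using A(1) avoid by (auto simp: Q_def)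
    then show ?thesis by blast
  qed
  then obtain f B where f: "\<And>t. t \<in> verts T \<Longrightarrow> Q t (f t) (B t)" by metis
  obtain t where t: "t \<in> verts T" "f (f t) = t"
    using acyclic_walk_turns_back[OF T, of f] f by (metis Q_def)
  define s where "s = f t"
  have Qt: "Q t s (B t)" using f[OF t(1)] by (simp add: s_def)
  then have ts: "adjacent T t s" by (simp add: Q_def)
  note s = adjacent_in_verts(2,3)[OF T(1) ts]
  have Qs: "Q s t (B s)" using f[OF s(1)] t(2) by (simp add: s_def)
  obtain l where l: "l \<in> edges T" "ends T l = {t, s}" using ts by (auto simp: adjacent_def)
  \<comment> \<open>The edges routed over the link \<open>l\<close> on which the walk turns back;
    this is the egg-cut of size at most the width.\<close>
  define D where "D = {e \<in> edges G. \<exists>p. routed_along G T X e p \<and> l \<in> path_links T p}"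
  let ?H = "delete_edges G D"
  have links: "{t, s} \<subseteq> set p" if "l \<in> path_links T p" for p
    using that l(2) by (auto simp: path_links_def edges_between_def doubleton_eq_iff)
  have egg: "(adjacent ?H)\<^sup>*\<^sup>* a b"
    if A: "A \<in> \<S>" "a \<in> A" "b \<in> A"
      and notD: "\<And>e. e \<in> edges G \<Longrightarrow> ends G e \<subseteq> A \<Longrightarrow> e \<notin> D" for A a b
  proof -
    have "(adjacent (induced G A))\<^sup>*\<^sup>* a b"
      using S A by (auto simp: scramble_def connected_graph_def induced_def)
    moreover have "adjacent (induced G A) x y \<Longrightarrow> adjacent ?H x y" for x y
      using notD by (fastforce simp: adjacent_def induced_def delete_edges_def)
    ultimately show ?thesis by (metis mono_rtranclp)
  qed
  \<comment> \<open>Being routed over \<open>l\<close> means visiting both \<open>t\<close> and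
    \<open>s\<close>, but edges inside \<open>B t\<close> avoid \<open>t\<close> and those inside
    \<open>B s\<close> avoid \<open>s\<close>.\<close>
  have notD: "e \<notin> D" if "e \<in> edges G" "ends G e \<subseteq> B t \<or> ends G e \<subseteq> B s" for e
    using that Qt Qs links by (fastforce simp: D_def Q_def)
  have BS: "B t \<in> \<S>" "B s \<in> \<S>" using Qt Qs by (auto simp: Q_def)
  then have "B t \<noteq> {}" "B s \<noteq> {}" "B t \<subseteq> verts G" "B s \<subseteq> verts G"
    using S by (auto simp: scramble_def)
  then obtain a b where ab: "a \<in> B t" "b \<in> B s" "a \<in> verts G" "b \<in> verts G" by blast
  let ?L = "\<lambda>x y. adjacent T x y \<and> {x, y} \<noteq> {t, s}"
  have symL: "?L\<^sup>*\<^sup>* y x" if "?L\<^sup>*\<^sup>* x y" for x y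
    by (rule rtranclp_sym[OF _ that]) (auto intro: adjacent_sym simp: insert_commute)
  \<comment> \<open>A walk from \<open>a\<close> to \<open>b\<close> without \<open>D\<close>
    projects to a walk in \<open>T\<close> without the link. Joined to the walks from
    \<open>s\<close> to \<open>X a\<close> in \<open>T - t\<close> and from \<open>t\<close> to
    \<open>X b\<close> in \<open>T - s\<close>, it would bypass the bridge between \<open>t\<close>
    and \<open>s\<close>.\<close>
  have sep: "\<not> (adjacent ?H)\<^sup>*\<^sup>* a b"
  proof
    have step: "?L\<^sup>*\<^sup>* (X x) (X y)" if xy: "adjacent ?H x y" for x y
    proof -
      obtain e where e: "e \<in> edges G" "e \<notin> D" "ends G e = {x, y}"
        using xy by (auto simp: adjacent_def delete_edges_def)
      then have "x \<in> verts G" "y \<in> verts G"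
        using adjacent_in_verts[OF G, of x y] by (auto simp: adjacent_def)
      then have "X x \<in> verts T" "X y \<in> verts T" using X by auto
      then obtain r where r: "path T (X x) r (X y)" by (rule path_exists[OF T(1)])
      then have nl: "l \<notin> path_links T r" using e by (auto simp: routed_along_def D_def)
      have "successively ?L r"
        unfolding successively_conv_nth
      proof (intro allI impI conjI)
        fix i assume i: "Suc i < length r"
        then show "adjacent T (r ! i) (r ! Suc i)"
          using r by (simp add: path_def successively_conv_nth)
        show "{r ! i, r ! Suc i} \<noteq> {t, s}"
          using i nl l by (auto simp: path_links_def edges_between_def)
      qed
      then show ?thesis
        using successively_rtranclp r by (metis (no_types, lifting) path_def)
    qed
    have lift: "?L\<^sup>*\<^sup>* (X x) (X y)" if "(adjacent ?H)\<^sup>*\<^sup>* x y" for x y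
      by (rule rtranclp_image[OF _ that]) (rule step)
    assume "(adjacent ?H)\<^sup>*\<^sup>* a b"
    then have ab_L: "?L\<^sup>*\<^sup>* (X a) (X b)" by (rule lift)
    have sa_L: "?L\<^sup>*\<^sup>* s (X a)"
    proof -
      have "(?R t)\<^sup>*\<^sup>* s (X a)" using Qt ab(1) by (simp add: Q_def)
      then show ?thesis
        by (rule mono_rtranclp[rule_format, rotated]) (auto simp: doubleton_eq_iff)
    qed
    have tb_L: "?L\<^sup>*\<^sup>* t (X b)"
    proof -
      have "(?R s)\<^sup>*\<^sup>* t (X b)" using Qs ab(2) by (simp add: Q_def)
      then show ?thesis
        by (rule mono_rtranclp[rule_format, rotated]) (auto simp: doubleton_eq_iff)
    qed
    from rtranclp_trans[OF tb_L symL[OF rtranclp_trans[OF sa_L ab_L]]] have "?L\<^sup>*\<^sup>* t s" .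
    with edge_is_bridge_if_acyclic[OF T(2) ts s(2)] show False by blast
  qed
  have comp: "{x. (adjacent ?H)\<^sup>*\<^sup>* v x} \<in> components ?H" if "v \<in> verts G" for v
    using that by (auto simp: components_def delete_edges_def)
  have sub: "B t \<subseteq> {x. (adjacent ?H)\<^sup>*\<^sup>* a x}" "B s \<subseteq> {x. (adjacent ?H)\<^sup>*\<^sup>* b x}"
    using egg[OF BS(1) ab(1)] egg[OF BS(2) ab(2)] notD by blast+
  have ne: "{x. (adjacent ?H)\<^sup>*\<^sup>* a x} \<noteq> {x. (adjacent ?H)\<^sup>*\<^sup>* b x}" using sep by blast
  have "D \<subseteq> edges G" by (auto simp: D_def)
  then have "egg_cut G \<S> D"
    unfolding egg_cut_def
    by (intro conjI bexI[OF _ comp[OF ab(3)]] bexI[OF _ comp[OF ab(4)]] ne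
        bexI[OF _ BS(1)] bexI[OF _ BS(2)] sub)
  then have "egg_cut_number G \<S> \<le> enat (card D)"
    unfolding egg_cut_number_def by (intro Inf_lower) blast
  also have "card D = link_weight G T X l" by (simp add: D_def link_weight_def)
  also have "enat (link_weight G T X l) \<le> enat (width G T X)" using link_le[OF l(1)] by simp
  finally show False using cut by simp
qed

lemma scramble_number_le_width:
  assumes "multigraph G" "tree_cut_decomposition G T X"
  shows "scramble_number G \<le> enat (width G T X)"
  unfolding scramble_number_def
proof (rule Max.boundedI)
  show "finite (scramble_order G ` {\<S>. scramble G \<S>})"
    using assms(1) by (intro finite_imageI finite_scrambles) (simp add: multigraph_def)
  \<comment> \<open>The empty scramble makes the set under \<open>Max\<close> nonempty.\<close>
  have "scramble G {}" by (simp add: scramble_def)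
  then show "scramble_order G ` {\<S>. scramble G \<S>} \<noteq> {}" by blast
qed (use scramble_order_le_width[OF assms] in auto)

section \<open>Upper bound: contracting thick bundles\<close>

text \<open>A longer path would be closed to a cycle by the adjacency of its ends. It determines the
  routes in the contracted tree.\<close>

lemma tree_path_adjacent:
  assumes "\<nexists>c. cycle T c" "path T a p b" "a = b \<or> adjacent T a b"
  shows "p = [a] \<or> p = [a, b]"
proof -
  consider "length p = 1" | "length p = 2" | "3 \<le> length p"
    using assms(2) by (cases "length p") (auto simp: path_def, linarith)
  then show ?thesis
  proof cases
    case 1
    then show ?thesis using assms(2) by (auto simp: path_def length_Suc_conv)
  next
    case 2
    then show ?thesis using assms(2) by (auto simp: path_def length_Suc_conv numeral_2_eq_2)
  next
    case 3
    then have "hd p \<noteq> last p"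
      using assms(2) by (cases p) (auto simp: path_def split: if_splits)
    then have "cycle T p"
      using 3 assms(2,3) by (auto simp: path_def cycle_def intro: adjacent_sym)
    with assms(1) show ?thesis by blast
  qed
qed


text \<open>Contracting all bundles of more than \<open>k\<close> edges turns \<open>G\<close> into a tree whose bags have
  at most \<open>k\<close> vertices and whose links carry one remaining bundle each.\<close>

lemma thin_tree_cut_decomposition:
  assumes G: "banana_tree G" and nocore: "\<not> has_banana_core G (Suc k)"
  obtains T :: "(nat, nat) mgraph" and X
  where "tree_cut_decomposition G T X" "width G T X \<le> k"
proof -
  have mG: "multigraph G" using G by (simp add: banana_tree_def)
  have fin: "finite (verts G)" "finite (edges G)" using mG by (auto simp: multigraph_def)
  have "adjacent (underlying_simple G) = adjacent G"
    by (auto simp: adjacent_def underlying_simple_def fun_eq_iff)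
  then have acyc: "\<nexists>c. cycle G c"
    using G by (simp add: banana_tree_def tree_def cycle_def)
  define thick where "thick u v \<longleftrightarrow> Suc k \<le> card (edges_between G u v)" for u v
  define C where "C u = {v. thick\<^sup>*\<^sup>* u v}" for u
  have thick_adj: "adjacent G u v" if "thick u v" for u v
  proof -
    have "edges_between G u v \<noteq> {}" using that by (auto simp: thick_def)
    then show ?thesis by (auto simp: edges_between_def adjacent_def)
  qed
  have "thick v u" if "thick u v" for u v
    using that by (simp add: thick_def edges_between_def insert_commute)
  then have thick_sym: "thick\<^sup>*\<^sup>* v u" if "thick\<^sup>*\<^sup>* u v" for u v
    using that rtranclp_sym by metis
  have C_eq: "C u = C v \<longleftrightarrow> thick\<^sup>*\<^sup>* u v" for u v
    unfolding C_def using thick_sym by (auto intro: rtranclp_trans)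
  have C_verts: "C u \<subseteq> verts G" if "u \<in> verts G" for u
  proof
    fix v assume "v \<in> C u"
    then have "thick\<^sup>*\<^sup>* u v" by (simp add: C_def)
    then show "v \<in> verts G"
      using that by induction (auto dest: thick_adj adjacent_in_verts(2)[OF mG])
  qed
  \<comment> \<open>\<open>?B u v\<close> is adjacency in \<open>G\<close> after deleting the whole
    bundle between \<open>u\<close> and \<open>v\<close>.\<close>
  let ?B = "\<lambda>u v x y. adjacent G x y \<and> {x, y} \<noteq> {u, v}"
  have bridge: "\<not> (?B u v)\<^sup>*\<^sup>* u v" if "adjacent G u v" for u v
    using edge_is_bridge_if_acyclic[OF acyc that adjacent_in_verts(3)[OF mG that]] .
  have thick_avoids: "(?B u v)\<^sup>*\<^sup>* x y" if "thick\<^sup>*\<^sup>* x y" "\<not> thick u v" for u v x y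
    using that(1)
  proof (rule rtranclp_mono[THEN predicate2D, rotated], intro predicate2I conjI)
    fix x y assume xy: "thick x y"
    then show "adjacent G x y" by (rule thick_adj)
    show "{x, y} \<noteq> {u, v}"
      using xy that(2) by (auto simp: thick_def edges_between_def)
  qed
  have card_C: "card (C u) \<le> k" if u: "u \<in> verts G" for u
  proof (rule ccontr)
    assume "\<not> card (C u) \<le> k"
    moreover have "connected_graph (induced G (C u))"
      unfolding connected_graph_def
    proof (intro conjI ballI)
      show "verts (induced G (C u)) \<noteq> {}" by (auto simp: induced_def C_def)
      have reach: "(adjacent (induced G (C u)))\<^sup>*\<^sup>* u y" if "thick\<^sup>*\<^sup>* u y" for y
        using that
      proof induction
        case (step y z)
        have "y \<in> C u" "z \<in> C u" using step.hyps by (auto simp: C_def)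
        then have "adjacent (induced G (C u)) y z"
          using thick_adj[OF step.hyps(2)] by (auto simp: adjacent_def induced_def)
        with step.IH show ?case by (rule rtranclp.rtrancl_into_rtrancl)
      qed simp
      fix x y assume "x \<in> verts (induced G (C u))" "y \<in> verts (induced G (C u))"
      then have "thick\<^sup>*\<^sup>* u x" "thick\<^sup>*\<^sup>* u y" by (auto simp: induced_def C_def)
      then show "(adjacent (induced G (C u)))\<^sup>*\<^sup>* x y"
        using reach adjacent_rtranclp_sym rtranclp_trans by metis
    qed
    moreover have "Suc k \<le> card (edges_between (induced G (C u)) x y)"
      if xy: "adjacent (induced G (C u)) x y" for x y
    proof -
      have "x \<in> C u" "y \<in> C u" and adj: "adjacent G x y"
        using xy by (auto simp: adjacent_def induced_def)
      then have "thick\<^sup>*\<^sup>* x y" using thick_sym by (auto simp: C_def intro: rtranclp_trans)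
      \<comment> \<open>Otherwise the thick walk joining \<open>x\<close> and \<open>y\<close>
        inside the class would avoid their bundle, which is a bridge.\<close>
      then have "thick x y" using thick_avoids[of x y x y] bridge[OF adj] by blast
      moreover have "edges_between (induced G (C u)) x y = edges_between G x y"
        using \<open>x \<in> C u\<close> \<open>y \<in> C u\<close> by (auto simp: edges_between_def induced_def)
      ultimately show ?thesis by (simp add: thick_def)
    qed
    ultimately have "has_banana_core G (Suc k)"
      unfolding has_banana_core_def using C_verts[OF u]
      by (intro exI[of _ "C u"]) auto
    with nocore show False by blast
  qed
  \<comment> \<open>Classes, and later links, are numbered because \<open>screewidth\<close> ranges
    over trees on natural numbers.\<close>
  obtain \<nu> :: "'a set \<Rightarrow> nat" where \<nu>: "inj_on \<nu> (C ` verts G)"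
    using fin(1) by (metis finite_imageI finite_imp_inj_to_nat_seg)
  define X where "X v = \<nu> (C v)" for v
  have X_eq: "X u = X v \<longleftrightarrow> thick\<^sup>*\<^sup>* u v" if "u \<in> verts G" "v \<in> verts G" for u v
    using that \<nu> C_eq[of u v] by (auto simp: X_def dest: inj_onD)
  have bag_avoids: "(?B u v)\<^sup>*\<^sup>* x y"
    if "\<not> thick u v" "x \<in> verts G" "y \<in> verts G" "X x = X y" for u v x y
    using thick_avoids[OF _ that(1)] X_eq[OF that(2,3)] that(4) by simp
  define L where "L = {{X u, X v} |u v. adjacent G u v \<and> X u \<noteq> X v}"
  have "L \<subseteq> Pow (X ` verts G)"
    by (auto simp: L_def dest: adjacent_in_verts[OF mG])
  then have finL: "finite L" using fin(1) by (meson finite_Pow_iff finite_imageI finite_subset)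
  obtain \<mu> :: "nat set \<Rightarrow> nat" where \<mu>: "inj_on \<mu> L"
    using finL by (metis finite_imp_inj_to_nat_seg)
  \<comment> \<open>A link is the code of its pair of nodes, so \<open>inv_into\<close> recovers its
    ends.\<close>
  define T where "T = \<lparr>verts = X ` verts G, edges = \<mu> ` L, ends = inv_into L \<mu>\<rparr>"
  have ends_T: "ends T (\<mu> l) = l" if "l \<in> L" for l
    using that \<mu> by (simp add: T_def)
  have edges_T: "edges T = \<mu> ` L" and verts_T: "verts T = X ` verts G"
    by (simp_all add: T_def)
  have adj_L: "adjacent T a b \<longleftrightarrow> {a, b} \<in> L" for a b
    by (auto simp: adjacent_def edges_T ends_T)
  have adj_T: "\<exists>u v. adjacent G u v \<and> X u = a \<and> X v = b \<and> a \<noteq> b" if "adjacent T a b" for a b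
    using that adjacent_sym unfolding adj_L L_def by (fastforce simp: doubleton_eq_iff)
  have adj_X: "X u = X v \<or> adjacent T (X u) (X v)" if "adjacent G u v" for u v
    using that unfolding adj_L L_def by blast
  have mT: "multigraph T"
    unfolding multigraph_def
  proof (intro conjI ballI)
    show "finite (verts T)" "finite (edges T)" using fin finL by (auto simp: verts_T edges_T)
    fix e assume "e \<in> edges T"
    then obtain u v where "ends T e = {X u, X v}" "adjacent G u v" "X u \<noteq> X v"
      by (auto simp: edges_T ends_T) (auto simp: L_def)
    then show "ends T e \<subseteq> verts T" "card (ends T e) = 2"
      using adjacent_in_verts[OF mG] by (auto simp: verts_T)
  next
    have "(adjacent T)\<^sup>*\<^sup>* (X u) (X v)" if "(adjacent G)\<^sup>*\<^sup>* u v" for u v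
      by (rule rtranclp_image[OF _ that]) (auto dest: adj_X)
    then show "connected_graph T"
      using mG by (auto simp: multigraph_def connected_graph_def verts_T)
  qed
  have acycT: "\<nexists>c. cycle T c"
  proof (rule acyclic_if_edges_are_bridges, rule notI)
    fix a b assume "adjacent T a b"
    then obtain u v where uv: "adjacent G u v" "X u = a" "X v = b" "a \<noteq> b"
      using adj_T by blast
    note uvV = adjacent_in_verts(1,2)[OF mG uv(1)]
    have nthick: "\<not> thick u v" using X_eq[OF uvV] uv by auto
    assume "(\<lambda>x y. adjacent T x y \<and> {x, y} \<noteq> {a, b})\<^sup>*\<^sup>* a b"
    \<comment> \<open>A walk in \<open>T\<close> avoiding a link is lifted to \<open>G\<close>. The
      induction covers all vertices of the bag reached, since the next bundle may leave from any of
      them.\<close>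
    then have "\<forall>w \<in> verts G. X w = b \<longrightarrow> (?B u v)\<^sup>*\<^sup>* u w"
    proof induction
      case base
      show ?case using bag_avoids[OF nthick uvV(1)] uv(2) by simp
    next
      case (step y z)
      obtain u' v' where e: "adjacent G u' v'" "X u' = y" "X v' = z"
        using adj_T step.hyps(2) by blast
      note V = adjacent_in_verts(1,2)[OF mG e(1)]
      have "{u', v'} \<noteq> {u, v}"
        using step.hyps(2) e uv(2,3) by (auto simp: doubleton_eq_iff)
      then have uv': "(?B u v)\<^sup>*\<^sup>* u v'"
        using step.IH V e by (auto intro: rtranclp.rtrancl_into_rtrancl)
      show ?case
      proof (intro ballI impI)
        fix w assume "w \<in> verts G" "X w = z"
        then have "(?B u v)\<^sup>*\<^sup>* v' w"
          using bag_avoids[OF nthick V(2)] e(3) by simp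
        with uv' show "(?B u v)\<^sup>*\<^sup>* u w" by (rule rtranclp_trans)
      qed
    qed
    with bridge[OF uv(1)] uv(3) uvV(2) show False by blast
  qed
  have "inj_on (ends T) (edges T)"
    by (rule inj_onI) (auto simp: edges_T ends_T)
  with mT acycT have tcd: "tree_cut_decomposition G T X"
    by (simp add: tree_cut_decomposition_def tree_def verts_T)
  have route: "\<exists>u v. ends G e = {u, v} \<and> adjacent G u v \<and> (p = [X u] \<or> p = [X u, X v])"
    if e: "e \<in> edges G" "routed_along G T X e p" for e p
  proof -
    obtain u v where uv: "ends G e = {u, v}" "path T (X u) p (X v)"
      using e(2) by (auto simp: routed_along_def)
    then have adj: "adjacent G u v" using e(1) by (auto simp: adjacent_def)
    from tree_path_adjacent[OF acycT uv(2) adj_X[OF adj]] uv adj show ?thesis by blast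
  qed
  have node: "node_weight G T X t \<le> k" if t: "t \<in> verts T" for t
  proof -
    obtain u where u: "u \<in> verts G" "t = X u" using t by (auto simp: verts_T)
    have "v \<in> verts G \<and> X v = t \<longleftrightarrow> v \<in> C u" for v
      using X_eq[OF u(1), of v] C_verts[OF u(1)] unfolding C_def u(2) by auto
    then have "{v \<in> verts G. X v = t} = C u" by blast
    \<comment> \<open>A route visits only the images of the two ends of its edge, so nothing passes
      over a foreign node.\<close>
    moreover have "{e \<in> edges G. (\<exists>p. routed_along G T X e p \<and> t \<in> set p) \<and>
        t \<notin> X ` ends G e} = {}"
      using route by fastforce
    ultimately have "node_weight G T X t = card (C u)"
      unfolding node_weight_def by (simp only: card.empty add_0_right)
    with card_C[OF u(1)] show ?thesis by simp
  qed
  have link: "link_weight G T X l \<le> k" if l: "l \<in> edges T" for l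
  proof -
    obtain u v where uv: "ends T l = {X u, X v}" "adjacent G u v" "X u \<noteq> X v"
      using l by (auto simp: edges_T ends_T) (auto simp: L_def)
    note uvV = adjacent_in_verts(1,2)[OF mG uv(2)]
    have nthick: "\<not> thick u v" using X_eq[OF uvV] uv(3) by auto
    \<comment> \<open>A second bundle between the same two bags would give a detour around
      \<open>u\<close>, \<open>v\<close>: within one bag, across, and within the other.\<close>
    have only: "{x, y} = {u, v}" if xy: "adjacent G x y" "X x = X u" "X y = X v" for x y
    proof (rule ccontr)
      assume ne: "{x, y} \<noteq> {u, v}"
      note V = adjacent_in_verts(1,2)[OF mG xy(1)]
      have ux: "(?B u v)\<^sup>*\<^sup>* u x" and yv: "(?B u v)\<^sup>*\<^sup>* y v"
        using bag_avoids[OF nthick uvV(1) V(1)] bag_avoids[OF nthick V(2) uvV(2)] xy(2,3)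
        by simp_all
      have "?B u v x y" using ne xy(1) by simp
      with ux have "(?B u v)\<^sup>*\<^sup>* u y" by (rule rtranclp.rtrancl_into_rtrancl)
      then have "(?B u v)\<^sup>*\<^sup>* u v" using yv by (rule rtranclp_trans)
      with bridge[OF uv(2)] show False by blast
    qed
    have "{e \<in> edges G. \<exists>p. routed_along G T X e p \<and> l \<in> path_links T p}
      \<subseteq> edges_between G u v"
    proof clarify
      fix e p assume e: "e \<in> edges G" "routed_along G T X e p" "l \<in> path_links T p"
      obtain x y where xy: "ends G e = {x, y}" "adjacent G x y" "p = [X x] \<or> p = [X x, X y]"
        using route[OF e(1,2)] by blast
      obtain i where i: "Suc i < length p" "ends T l = {p ! i, p ! Suc i}"
        using e(3) unfolding path_links_def edges_between_def by blast
      then have "p = [X x, X y]" "i = 0" using xy(3) by auto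
      then have "{X x, X y} = {X u, X v}" using i(2) uv(1) by simp
      then consider "X x = X u" "X y = X v" | "X y = X u" "X x = X v"
        unfolding doubleton_eq_iff by blast
      then have "{x, y} = {u, v}"
        using only[OF xy(2)] only[OF adjacent_sym[OF xy(2)]] by cases (auto simp: insert_commute)
      with e(1) xy(1) show "e \<in> edges_between G u v" by (simp add: edges_between_def)
    qed
    then have "link_weight G T X l \<le> card (edges_between G u v)"
      unfolding link_weight_def using fin(2) by (intro card_mono) (auto simp: edges_between_def)
    with nthick show ?thesis by (simp add: thick_def)
  qed
  have "width G T X \<le> k"
    unfolding width_def
  proof (rule Max.boundedI)
    show "finite (node_weight G T X ` verts T \<union> link_weight G T X ` edges T)"
      using mT by (simp add: multigraph_def)
    show "node_weight G T X ` verts T \<union> link_weight G T X ` edges T \<noteq> {}"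
      using mT by (simp add: multigraph_def connected_graph_def)
  qed (use node link in auto)
  with tcd that show thesis by blast
qed

section \<open>Existence of the maximum and conclusion\<close>

text \<open>A single vertex suffices, the bundle condition being vacuous without loops. This gives
  \<open>GREATEST\<close> a candidate.\<close>

lemma has_banana_core_1:
  assumes "multigraph G"
  shows "has_banana_core G 1"
proof -
  obtain v where v: "v \<in> verts G"
    using assms by (auto simp: multigraph_def connected_graph_def)
  have "\<not> adjacent (induced G {v}) x y" for x y
  proof
    assume "adjacent (induced G {v}) x y"
    then have "adjacent G x y" "x = v" "y = v" by (auto simp: adjacent_def induced_def)
    with adjacent_in_verts(3)[OF assms] show False by blast
  qed
  with v show ?thesis
    unfolding has_banana_core_def
    by (intro exI[of _ "{v}"]) (auto simp: connected_graph_def induced_def)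
qed

theorem theorem3p1:
  fixes G :: "('v, 'e) mgraph" and k :: nat
  assumes "banana_tree G"
    and "k = (GREATEST j. 0 < j \<and> has_banana_core G j)"
  shows "scramble_number G = enat k \<and> screewidth G = k"
proof -
  have G: "multigraph G" using assms(1) by (simp add: banana_tree_def)
  let ?P = "\<lambda>j. 0 < j \<and> has_banana_core G j"
  \<comment> \<open>The core size bounds the candidates, so the maximum is attained.\<close>
  have bound: "j \<le> card (verts G)" if "?P j" for j
    using that G by (auto simp: has_banana_core_def multigraph_def intro: card_mono order_trans)
  have "?P 1" using has_banana_core_1[OF G] by simp
  then have "?P k"
    unfolding assms(2) using bound by (rule GreatestI_nat)
  have "\<not> has_banana_core G (Suc k)"
  proof
    assume "has_banana_core G (Suc k)"
    then have "Suc k \<le> k"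
      unfolding assms(2) using bound by (intro Greatest_le_nat) auto
    then show False by simp
  qed
  then obtain T :: "(nat, nat) mgraph" and X
    where T: "tree_cut_decomposition G T X" "width G T X \<le> k"
    by (rule thin_tree_cut_decomposition[OF assms(1)])
  let ?W = "\<lambda>w. \<exists>(T :: (nat, nat) mgraph) X. tree_cut_decomposition G T X \<and> width G T X = w"
  have "?W (width G T X)" using T(1) by blast
  \<comment> \<open>\<open>LeastI\<close> supplies a decomposition attaining the screewidth, to
    which the general width bound applies.\<close>
  then have "screewidth G \<le> width G T X" and "?W (screewidth G)"
    unfolding screewidth_def by (rule Least_le, rule LeastI)
  then have "scramble_number G \<le> enat (screewidth G)"
    using scramble_number_le_width[OF G] by metis
  moreover have "screewidth G \<le> k" using \<open>screewidth G \<le> width G T X\<close> T(2) by simp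
  moreover have "enat k \<le> scramble_number G"
    using scramble_number_ge_core[OF G] \<open>?P k\<close> by blast
  ultimately show ?thesis
    by (metis enat_ord_simps(1) order.antisym order.trans)
qed

end
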